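(* For every fixed integer $d\ge 1$, $$\lim_{k\to\infty}\frac{N_d(k)}{k}=1.$$
   Context: A nice measure on $\mathbb{R}^d$ is a finite nonzero Borel measure that has a continuous, everywhere strictly positive density with respect to Lebesgue measure. A convex partition of $\mathbb{R}^d$ into $n$ parts is a covering of $\mathbb{R}^d$ by $n$ closed convex sets (possibly unbounded, with nonempty interior) whose interiors are pairwise disjoint. An (affine) hyperplane avoids a set $C$ if it does not intersect the interior of $C$. For a positive integer $k$, $N_d(k)$ denotes the smallest positive integer $n$ such that for every nice measure $\mu$ on $\mathbb{R}^d$ there exists a convex partition of $\mathbb{R}^d$ into $n$ parts of equal $\mu$-measure such that every hyperplane avoids at least $k$ of the parts. *)

theory Defs
  imports "HOL-Analysis.Analysis"
begin

definition nice_measure :: "'a::euclidean_space measure \<Rightarrow> bool" where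
  "nice_measure M \<longleftrightarrow>
     sets M = sets borel \<and> finite_measure M \<and> emeasure M UNIV \<noteq> 0 \<and>
     (\<exists>f :: 'a \<Rightarrow> real. continuous_on UNIV f \<and> (\<forall>x. 0 < f x) \<and>
        M = density lborel (\<lambda>x. ennreal (f x)))"

(* Representing the n parts as a set of cardinality n loses nothing: sets with
   nonempty, pairwise disjoint interiors are distinct. *)
definition convex_partition :: "nat \<Rightarrow> 'a::euclidean_space set set \<Rightarrow> bool" where
  "convex_partition n P \<longleftrightarrow>
     finite P \<and> card P = n \<and> \<Union>P = UNIV \<and>
     (\<forall>C\<in>P. closed C \<and> convex C \<and> interior C \<noteq> {}) \<and>
     pairwise (\<lambda>C D. interior C \<inter> interior D = {}) P"

definition is_hyperplane :: "'a::euclidean_space set \<Rightarrow> bool" where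
  "is_hyperplane H \<longleftrightarrow> (\<exists>a b. a \<noteq> 0 \<and> H = {x. a \<bullet> x = b})"

definition avoids :: "'a::euclidean_space set \<Rightarrow> 'a set \<Rightarrow> bool" where
  "avoids H C \<longleftrightarrow> H \<inter> interior C = {}"

definition good_number :: "'a::euclidean_space itself \<Rightarrow> nat \<Rightarrow> nat \<Rightarrow> bool" where
  "good_number T k n \<longleftrightarrow>
     (\<forall>M :: 'a measure. nice_measure M \<longrightarrow>
        (\<exists>P. convex_partition n P \<and>
             (\<forall>C\<in>P. \<forall>D\<in>P. emeasure M C = emeasure M D) \<and>
             (\<forall>H. is_hyperplane H \<longrightarrow> k \<le> card {C \<in> P. avoids H C})))"

(* The dimension d is that of the type argument. If no n were good for some k, then
   none would be for any larger k, and LEAST would be the same unspecified number for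
   all of these; so avoidance_number k / k tending to 1 entails that a good n exists
   for every k. *)
definition avoidance_number :: "'a::euclidean_space itself \<Rightarrow> nat \<Rightarrow> nat" where
  "avoidance_number T k = (LEAST n. 0 < n \<and> good_number T k n)"

end

theory Submission
  imports Defs "HOL-Probability.Probability" "HOL-Real_Asymp.Real_Asymp"
begin

text \<open>
  Write \<open>d\<close> for the dimension. Trivially the avoidance number of \<open>k\<close> is at least \<open>k\<close>. For the
  asymptotic upper bound it suffices to cut a nice measure into \<open>n\<close> convex parts of equal measure
  such that every hyperplane crosses only \<open>o(n)\<close> of them, uniformly in the measure.

  The heart is a weaker statement: there are constants, depending only on \<open>d\<close>, such that each convex
  piece of sufficiently many units can be cut into boundedly many convex pieces, all of integral
  measure (in units of one \<open>n\<close>-th of the total), so that every hyperplane misses a piece that carries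
  at least the fraction \<open>missed d\<close> of the measure. This is \<open>tiling_every_hyperplane_misses\<close>. Applying
  it recursively inside the pieces to depth \<open>t\<close> leaves at most \<open>(1 - missed d) ^ t * n + O(1)\<close> crossed
  units, which is \<open>unit_tiling_few_crossed\<close>.

  To find the pieces, begin with \<open>d + 1\<close> parallel slabs and shrink them until, for every set \<open>J\<close> of
  indices, a hyperplane separates those in \<open>J\<close> from the others. By Radon's theorem no hyperplane then
  meets the interiors of all of them (\<open>no_hyperplane_transversal\<close>). Each separation needs only an
  approximate ham-sandwich cut, for which no theorem of Borsuk-Ulam type is required: a hyperplane through centerpoints
  of \<open>d\<close> of the sets leaves a fixed fraction of each of them on both sides, and the last set merely
  decides the orientation (\<open>separate_step\<close>). Centerpoints come from Helly's theorem (\<open>centerpoint\<close>).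
  Integrality is restored by translating the cutting hyperplane separately within each set, away from
  the other side, which does not harm the separation (\<open>carve_halfspace\<close>).
\<close>

section \<open>Separation and hyperplane transversals\<close>

lemma hyperplane_through_points:
  fixes c :: "nat \<Rightarrow> 'a::euclidean_space"
  shows "\<exists>a b. a \<noteq> 0 \<and> (\<forall>i<DIM('a). a \<bullet> c i = b)"
proof -
  let ?V = "(\<lambda>i. c i - c 0) ` {1..<DIM('a)}"
  have "dim ?V \<le> card ?V" by (intro dim_le_card') simp
  also have "\<dots> \<le> card {1..<DIM('a)}" by (intro card_image_le) simp
  also have "\<dots> < DIM('a)" using DIM_positive[where 'a='a] by simp
  finally obtain a :: 'a where a: "a \<noteq> 0" "span ?V \<subseteq> {x. a \<bullet> x = 0}"
    using lowdim_subset_hyperplane by blast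
  have "a \<bullet> c i = a \<bullet> c 0" if "i < DIM('a)" for i
  proof (cases "i = 0")
    case False
    then have "c i - c 0 \<in> span ?V" using that by (intro span_base) auto
    then show ?thesis using a(2) by (auto simp: inner_diff_right)
  qed simp
  then show ?thesis using a(1) by blast
qed

text \<open>
  Some hyperplane has the sets \<open>Y i\<close> with \<open>i \<in> J\<close> on one side and the other ones among
  \<open>Y 0, \<dots>, Y d\<close> on the opposite side, where \<open>d\<close> is the dimension. The half-spaces are closed.
\<close>

definition separated :: "(nat \<Rightarrow> 'a::euclidean_space set) \<Rightarrow> nat set \<Rightarrow> bool" where
  "separated Y J \<longleftrightarrow> (\<exists>a b. a \<noteq> 0 \<and> 
     (\<forall>i\<le>DIM('a). Y i \<subseteq> (if i \<in> J then {x. a \<bullet> x \<le> b} else {x. a \<bullet> x \<ge> b})))"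

lemma separated_mono:
  fixes Y :: "nat \<Rightarrow> 'a::euclidean_space set"
  shows "separated Y J \<Longrightarrow> (\<And>i. i \<le> DIM('a) \<Longrightarrow> Z i \<subseteq> Y i) \<Longrightarrow> separated Z J"
  unfolding separated_def by (meson order_trans)

text \<open>
  A hyperplane that meets all the interiors contains \<open>d + 1\<close> points, one in each. They are affinely
  dependent, so by Radon's theorem they fall into two classes whose convex hulls intersect. But the
  corresponding sets are separated, and interior points lie strictly on their side.
\<close>

lemma no_hyperplane_transversal:
  fixes Y :: "nat \<Rightarrow> 'a::euclidean_space set"
  assumes sep: "\<And>J. J \<subseteq> {..DIM('a)} \<Longrightarrow> separated Y J"
    and disj: "\<And>i j. i \<le> DIM('a) \<Longrightarrow> j \<le> DIM('a) \<Longrightarrow> i \<noteq> j \<Longrightarrow> interior (Y i) \<inter> interior (Y j) = {}"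
    and H: "is_hyperplane H"
  shows "\<exists>i\<le>DIM('a). avoids H (Y i)"
proof (rule ccontr)
  assume "\<not> ?thesis"
  then have "\<forall>i. \<exists>x. i \<le> DIM('a) \<longrightarrow> x \<in> H \<inter> interior (Y i)" by (auto simp: avoids_def)
  then obtain p where p: "\<And>i. i \<le> DIM('a) \<Longrightarrow> p i \<in> H \<inter> interior (Y i)" by metis
  have inj: "inj_on p {..DIM('a)}"
  proof (rule inj_onI, rule ccontr)
    fix i j assume ij: "i \<in> {..DIM('a)}" "j \<in> {..DIM('a)}" "p i = p j" "i \<noteq> j"
    then show False using p[of i] p[of j] disj[of i j] by auto
  qed
  define S where "S = p ` {..DIM('a)}"
  have cS: "card S = DIM('a) + 1" unfolding S_def using inj by (simp add: card_image)
  obtain a b where ab: "a \<noteq> 0" "H = {x. a \<bullet> x = b}" using H by (auto simp: is_hyperplane_def)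
  have "S \<subseteq> H" using p by (auto simp: S_def)
  then have "aff_dim S \<le> DIM('a) - 1"
    using aff_dim_subset[of S H] ab DIM_positive[where 'a='a] by (simp add: aff_dim_hyperplane of_nat_diff)
  then have "affine_dependent S"
    using affine_independent_iff_card[of S] cS DIM_positive[where 'a='a] by auto
  then obtain U V where UV: "U \<subseteq> S" "V \<subseteq> S" "U \<inter> V = {}" "convex hull U \<inter> convex hull V \<noteq> {}"
    by (rule Radon)
  define J where "J = {i \<in> {..DIM('a)}. p i \<in> U}"
  obtain a' b' where a': "a' \<noteq> 0" and
    Y: "\<And>i. i \<le> DIM('a) \<Longrightarrow> Y i \<subseteq> (if i \<in> J then {x. a' \<bullet> x \<le> b'} else {x. a' \<bullet> x \<ge> b'})"
    using sep[of J] by (auto simp: separated_def J_def)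
  have "convex hull U \<subseteq> {x. a' \<bullet> x < b'}"
  proof (rule hull_minimal)
    show "U \<subseteq> {x. a' \<bullet> x < b'}"
    proof
      fix x assume "x \<in> U"
      then obtain i where i: "i \<le> DIM('a)" "x = p i" "i \<in> J" using UV(1) by (auto simp: S_def J_def)
      then have "Y i \<subseteq> {x. a' \<bullet> x \<le> b'}" using Y[of i] by simp
      then have "x \<in> interior {x. a' \<bullet> x \<le> b'}" using p[of i] i interior_mono by blast
      then show "x \<in> {x. a' \<bullet> x < b'}" using a' by simp
    qed
  qed (rule convex_halfspace_lt)
  moreover have "convex hull V \<subseteq> {x. a' \<bullet> x > b'}"
  proof (rule hull_minimal)
    show "V \<subseteq> {x. a' \<bullet> x > b'}"
    proof
      fix x assume "x \<in> V"
      then obtain i where i: "i \<le> DIM('a)" "x = p i" "i \<notin> J" using UV(2,3) by (auto simp: S_def J_def)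
      then have "Y i \<subseteq> {x. a' \<bullet> x \<ge> b'}" using Y[of i] by simp
      then have "x \<in> interior {x. a' \<bullet> x \<ge> b'}" using p[of i] i interior_mono by blast
      then show "x \<in> {x. a' \<bullet> x > b'}" using a' by simp
    qed
  qed (rule convex_halfspace_gt)
  ultimately show False using UV(4) by fastforce
qed

section \<open>Tilings by convex sets of integral measure\<close>

lemma measure_convex_interior:
  fixes M :: "'a::euclidean_space measure"
  assumes "sets M = sets borel" "absolutely_continuous lborel M" "closed C" "convex C"
  shows "measure M (interior C) = measure M C"
proof -
  have "negligible (C - interior C)"
    using negligible_convex_frontier[OF \<open>convex C\<close>] assms(3) by (simp add: frontier_def closure_closed)
  moreover have "C - interior C \<in> sets borel"
    using assms(3) by (auto intro: borel_closed borel_open)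
  ultimately have "C - interior C \<in> null_sets lborel"
    by (simp add: negligible_iff_null_sets null_sets_completion_iff)
  then have "C - interior C \<in> null_sets M"
    using assms(2) by (auto simp: absolutely_continuous_def)
  moreover have "interior C \<in> sets M" using assms(1) by auto
  ultimately have "measure M (interior C \<union> (C - interior C)) = measure M (interior C)"
    by (intro measure_Un_null_set) auto
  moreover have "interior C \<union> (C - interior C) = C"
    using interior_subset by blast
  ultimately show ?thesis by simp
qed

text \<open>
  A finite absolutely continuous measure together with a unit of measure \<open>w\<close>.
\<close>

locale unit_measure = finite_measure M
  for M :: "'a::euclidean_space measure" +
  fixes w :: real
  assumes sets_M: "sets M = sets borel"
    and abs_cont: "absolutely_continuous lborel M"
    and w_pos: "w > 0"
begin

text \<open>
  A tile is a closed convex set whose measure is a positive integer multiple, here \<open>j\<close>, of the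
  unit \<open>w\<close>. Keeping all measures integral in this sense is what allows every tile to be cut
  further into pieces of measure exactly \<open>w\<close>.
\<close>

definition tile :: "nat \<Rightarrow> 'a set \<Rightarrow> bool" where
  "tile j D \<longleftrightarrow> closed D \<and> convex D \<and> 0 < j \<and> measure M D = real j * w"

text \<open>
  A finite subdivision of \<open>C\<close> into tiles with pairwise disjoint interiors.
\<close>

definition tiling :: "'a set \<Rightarrow> 'a set set \<Rightarrow> bool" where
  "tiling C P \<longleftrightarrow> finite P \<and> \<Union>P = C \<and> (\<forall>D\<in>P. \<exists>j. tile j D) \<and>
     pairwise (\<lambda>D E. interior D \<inter> interior E = {}) P"

lemma space_M: "space M = UNIV"
  using sets_eq_imp_space_eq[OF sets_M] by simp

lemma closed_sets [simp, intro]: "closed C \<Longrightarrow> C \<in> sets M"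
  by (simp add: sets_M)

lemma open_sets [simp, intro]: "open C \<Longrightarrow> C \<in> sets M"
  by (simp add: sets_M)

lemma measure_hyperplane_0:
  assumes "a \<noteq> 0"
  shows "measure M {x. a \<bullet> x = b} = 0"
proof -
  have "measure M (interior {x. a \<bullet> x = b}) = measure M {x. a \<bullet> x = b}"
    using measure_convex_interior[OF sets_M abs_cont closed_hyperplane convex_hyperplane] .
  then show ?thesis using assms by simp
qed

lemma tile_interior_nonempty:
  assumes "tile j D" shows "interior D \<noteq> {}"
proof
  assume "interior D = {}"
  then have "measure M D = 0"
    using measure_convex_interior[OF sets_M abs_cont, of D] assms by (simp add: tile_def)
  then show False using assms w_pos by (auto simp: tile_def)
qed

lemma tiling_self: "tile j D \<Longrightarrow> tiling D {D}"
  by (auto simp: tiling_def)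

lemma tiling_member: "tiling C P \<Longrightarrow> D \<in> P \<Longrightarrow> D \<subseteq> C \<and> closed D \<and> convex D"
  unfolding tiling_def tile_def by blast

lemma measure_tiling:
  assumes "tiling C P"
  shows "measure M C = (\<Sum>D\<in>P. measure M D)"
proof -
  have fin: "finite P" and un: "\<Union>P = C" and t: "\<And>D. D \<in> P \<Longrightarrow> \<exists>j. tile j D"
    and disj: "pairwise (\<lambda>D E. interior D \<inter> interior E = {}) P"
    using assms by (auto simp: tiling_def)
  have cl: "closed D" "convex D" if "D \<in> P" for D using t[OF that] by (auto simp: tile_def)
  have "(\<Sum>D\<in>P. measure M D) = (\<Sum>D\<in>P. measure M (interior D))"
    using cl by (intro sum.cong refl) (simp add: measure_convex_interior[OF sets_M abs_cont])
  also have "\<dots> = measure M (\<Union>D\<in>P. interior D)"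
    using disj by (intro finite_measure_finite_Union[symmetric] fin)
      (auto simp: disjoint_family_on_def pairwise_def)
  also have "\<dots> \<le> measure M C"
    using un interior_subset fin cl by (intro finite_measure_mono) (auto intro!: sets.finite_Union)
  finally have 1: "(\<Sum>D\<in>P. measure M D) \<le> measure M C" .
  have "measure M C \<le> (\<Sum>D\<in>P. measure M D)"
    unfolding un[symmetric] using finite_measure_subadditive_finite[of P "\<lambda>D. D"] fin cl by auto
  with 1 show ?thesis by simp
qed

lemma tiling_refine:
  assumes P: "tiling C P" and Q: "\<And>D. D \<in> P \<Longrightarrow> tiling D (Q D)"
  shows "tiling C (\<Union>D\<in>P. Q D)"
proof -
  have "interior E \<inter> interior F = {}"
    if "D \<in> P" "E \<in> Q D" "D' \<in> P" "F \<in> Q D'" "E \<noteq> F" for D D' E F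
  proof (cases "D = D'")
    case True
    then show ?thesis using that Q[OF \<open>D \<in> P\<close>] by (auto simp: tiling_def pairwise_def)
  next
    case False
    then have "interior D \<inter> interior D' = {}" using P that by (auto simp: tiling_def pairwise_def)
    moreover have "E \<subseteq> D" "F \<subseteq> D'" using Q that tiling_member by blast+
    ultimately show ?thesis using interior_mono by blast
  qed
  then have "pairwise (\<lambda>D E. interior D \<inter> interior E = {}) (\<Union>D\<in>P. Q D)"
    unfolding pairwise_def by blast
  moreover have "\<Union>(\<Union>D\<in>P. Q D) = C"
  proof -
    have "\<Union>(\<Union>D\<in>P. Q D) = (\<Union>D\<in>P. \<Union>(Q D))" by blast
    also have "\<dots> = (\<Union>D\<in>P. D)" using Q by (intro SUP_cong refl) (auto simp: tiling_def)
    finally show ?thesis using P by (simp add: tiling_def)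
  qed
  ultimately show ?thesis using P Q unfolding tiling_def by blast
qed

text \<open>
  The measure of the part of \<open>D\<close> below the level \<open>b\<close> of a linear functional is the cumulative
  distribution function of a measure on the line. It has no atoms, because hyperplanes are null
  sets, so the intermediate value theorem applies.
\<close>

lemma measure_section_continuous:
  assumes D: "closed D" and a: "a \<noteq> 0" and y: "0 < y" "y < measure M D"
  shows "\<exists>b. measure M (D \<inter> {x. a \<bullet> x \<le> b}) = y"
proof -
  define N where "N = distr (restrict_space M D) borel (\<lambda>x. a \<bullet> x)"
  have DM: "D \<in> sets M" using D by simp
  have meas: "(\<lambda>x. a \<bullet> x) \<in> measurable (restrict_space M D) borel"
    by (intro measurable_restrict_space1) (simp add: measurable_cong_sets[OF sets_M refl])
  interpret R: finite_measure "restrict_space M D"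
    using DM by (intro finite_measure_restrict_space) (auto simp: finite_measure_axioms)
  have NA: "measure N A = measure M (D \<inter> {x. a \<bullet> x \<in> A})" if "A \<in> sets borel" for A
  proof -
    have "measure N A = measure (restrict_space M D) ((\<lambda>x. a \<bullet> x) -` A \<inter> D)"
      unfolding N_def using that meas DM
      by (subst measure_distr) (auto simp: space_restrict_space space_M)
    also have "\<dots> = measure M (D \<inter> {x. a \<bullet> x \<in> A})"
      using DM by (subst measure_restrict_space) (auto simp: space_M intro!: arg_cong[where f="measure M"])
    finally show ?thesis .
  qed
  interpret N: finite_borel_measure N
    unfolding N_def finite_borel_measure_def finite_borel_measure_axioms_def
    using R.finite_measure_distr[OF meas] by simp
  have cdf: "cdf N b = measure M (D \<inter> {x. a \<bullet> x \<le> b})" for b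
    unfolding cdf_def by (subst NA) auto
  have "measure N {b} = 0" for b
  proof -
    have "measure M (D \<inter> {x. a \<bullet> x = b}) \<le> measure M {x. a \<bullet> x = b}"
      by (intro finite_measure_mono) (auto simp: closed_hyperplane)
    then have "measure M (D \<inter> {x. a \<bullet> x = b}) = 0"
      using measure_hyperplane_0[OF a, of b] measure_nonneg[of M] by (simp add: order_antisym)
    then show ?thesis by (subst NA) auto
  qed
  then have cont: "isCont (cdf N) b" for b by (simp add: N.isCont_cdf)
  have tot: "measure N (space N) = measure M D"
    using NA[of UNIV] by (simp add: N.borel_UNIV)
  from order_tendstoD(1)[OF N.cdf_lim_at_top, of y] y tot
  obtain b1 where b1: "cdf N b1 > y" by (auto simp: eventually_at_top_linorder)
  from order_tendstoD(2)[OF N.cdf_lim_at_bot, of y] y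
  obtain b0 where b0: "cdf N b0 < y" by (auto simp: eventually_at_bot_linorder)
  have "b0 \<le> b1" using b0 b1 N.cdf_nondecreasing[of b1 b0] by linarith
  then obtain b where "cdf N b = y"
    using IVT[of "cdf N" b0 y b1] b0 b1 cont by auto
  then show ?thesis using cdf by auto
qed

lemma halfspace_cut:
  assumes D: "tile n D" and a: "a \<noteq> 0" and j: "0 < j" "j < n"
  shows "\<exists>b. tile j (D \<inter> {x. a \<bullet> x \<le> b}) \<and> tile (n - j) (D \<inter> {x. a \<bullet> x \<ge> b}) \<and>
             interior (D \<inter> {x. a \<bullet> x \<le> b}) \<inter> interior (D \<inter> {x. a \<bullet> x \<ge> b}) = {} \<and>
             tiling D {D \<inter> {x. a \<bullet> x \<le> b}, D \<inter> {x. a \<bullet> x \<ge> b}}"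
proof -
  have cl: "closed D" "convex D" and mD: "measure M D = real n * w" using D by (auto simp: tile_def)
  obtain b where b: "measure M (D \<inter> {x. a \<bullet> x \<le> b}) = real j * w"
    using measure_section_continuous[OF cl(1) a, of "real j * w"] mD j w_pos by auto
  define A where "A = D \<inter> {x. a \<bullet> x \<le> b}"
  define B where "B = D \<inter> {x. a \<bullet> x \<ge> b}"
  have AB: "closed A" "closed B" "convex A" "convex B"
    unfolding A_def B_def using cl
    by (auto intro!: closed_Int convex_Int closed_halfspace_le closed_halfspace_ge convex_halfspace_le convex_halfspace_ge)
  have "interior A \<subseteq> {x. a \<bullet> x < b}" "interior B \<subseteq> {x. a \<bullet> x > b}"
    using interior_mono[of A "{x. a \<bullet> x \<le> b}"] interior_mono[of B "{x. a \<bullet> x \<ge> b}"] a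
    by (auto simp: A_def B_def)
  then have disj: "interior A \<inter> interior B = {}" by fastforce
  have un: "A \<union> B = D" by (auto simp: A_def B_def)
  have "measure M (A \<inter> B) \<le> measure M {x. a \<bullet> x = b}"
    by (intro finite_measure_mono) (auto simp: A_def B_def closed_hyperplane)
  then have "measure M (A \<inter> B) = 0"
    using measure_hyperplane_0[OF a, of b] measure_nonneg[of M] by (simp add: order_antisym)
  moreover have "measure M (A \<union> B) = measure M A + measure M B - measure M (A \<inter> B)"
    using AB by (intro measure_Un3) (auto simp: fmeasurable_eq_sets)
  ultimately have "measure M B = real (n - j) * w"
    using un mD b j by (simp add: A_def[symmetric] of_nat_diff algebra_simps)
  then have tiles: "tile j A" "tile (n - j) B"
    using AB b j by (auto simp: tile_def A_def[symmetric])
  have "tiling D {A, B}" 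
    using un tiles disj unfolding tiling_def by (auto simp: pairwise_insert)
  then show ?thesis using tiles disj unfolding A_def B_def by blast
qed

text \<open>
  Successive cuts by parallel hyperplanes: \<open>p\<close> tiles of \<open>k\<close> units each and a remainder \<open>R\<close>.
\<close>

lemma slabs:
  assumes "tile n C" "0 < k" "p * k < n"
  shows "\<exists>S R. tiling C (insert R S) \<and> R \<notin> S \<and> finite S \<and> card S = p \<and> (\<forall>D\<in>S. tile k D) \<and>
               tile (n - p * k) R"
  using assms
proof (induction p arbitrary: n C)
  case 0
  then show ?case by (intro exI[of _ "{}"] exI[of _ C]) (simp add: tiling_self)
next
  case (Suc p)
  obtain a :: 'a where a: "a \<noteq> 0" using nonzero_Basis SOME_Basis by blast
  have kn: "k < n" using Suc.prems by (metis le_add1 mult_Suc order.strict_trans1)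
  obtain A B where A: "tile k A" and B: "tile (n - k) B" and AB: "tiling C {A, B}"
    and disj: "interior A \<inter> interior B = {}"
    using halfspace_cut[OF Suc.prems(1) a \<open>0 < k\<close> kn] by blast
  have "p * k < n - k" using Suc.prems by simp
  then obtain S R where S: "tiling B (insert R S)" "R \<notin> S" "finite S" "card S = p"
    "\<forall>D\<in>S. tile k D" "tile (n - k - p * k) R"
    using Suc.IH[OF B \<open>0 < k\<close>] by blast
  have nsub: "\<not> A \<subseteq> B" using tile_interior_nonempty[OF A] disj interior_mono by blast
  then have A_notin: "A \<notin> insert R S" using S(1) tiling_member by blast
  have "A \<noteq> B" using nsub by blast
  define Q where "Q D = (if D = A then {A} else insert R S)" for D
  have "tiling C (\<Union>D\<in>{A, B}. Q D)"
    using AB A S(1) \<open>A \<noteq> B\<close> by (intro tiling_refine) (auto simp: Q_def tiling_self)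
  moreover have "(\<Union>D\<in>{A, B}. Q D) = insert R (insert A S)"
    using \<open>A \<noteq> B\<close> by (auto simp: Q_def)
  ultimately show ?case using S A A_notin
    by (intro exI[of _ "insert A S"] exI[of _ R]) (auto simp: algebra_simps)
qed

lemma unit_tiling_exists:
  assumes "tile n C"
  shows "\<exists>P. tiling C P \<and> (\<forall>D\<in>P. tile 1 D)"
proof -
  have "0 < n" using assms by (simp add: tile_def)
  then obtain S R where "tiling C (insert R S)" "\<forall>D\<in>S. tile 1 D" "tile (n - (n - 1)) R"
    using slabs[OF assms, of 1 "n - 1"] by auto
  then show ?thesis using \<open>0 < n\<close> by (intro exI[of _ "insert R S"]) auto
qed

lemma unit_tiling_card:
  assumes "tile n C" "tiling C P" "\<forall>D\<in>P. tile 1 D"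
  shows "card P = n"
proof -
  have "real n * w = measure M C" using assms(1) by (simp add: tile_def)
  also have "\<dots> = (\<Sum>D\<in>P. w)"
    unfolding measure_tiling[OF assms(2)] using assms(3) by (intro sum.cong) (auto simp: tile_def)
  finally show ?thesis using w_pos by simp
qed

section \<open>Centerpoints\<close>

text \<open>
  The centerpoint theorem, for the restriction of the measure to \<open>D\<close>: every closed half-space with
  \<open>c\<close> on its boundary contains at least the fraction \<open>1 / (d + 1)\<close> of \<open>D\<close>. Such a point lies in all
  compact convex sets that miss less than this fraction. Any \<open>d + 1\<close> of these sets have a common
  point, so Helly's theorem and compactness give a point common to all of them.
\<close>

lemma centerpoint:
  assumes D: "closed D"
  shows "\<exists>c. \<forall>a. measure M D \<le> real (DIM('a) + 1) * measure M (D \<inter> {x. a \<bullet> x \<le> a \<bullet> c})"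
proof (cases "measure M D = 0")
  case True
  then show ?thesis by auto
next
  case False
  then have pos: "measure M D > 0" by (simp add: order.strict_iff_order)
  let ?d = "real (DIM('a) + 1)"
  have DM: "D \<in> sets M" using D by simp
  define F where "F = {S. compact S \<and> convex S \<and> ?d * (measure M D - measure M (D \<inter> S)) < measure M D}"
  have small: "\<Inter>t \<noteq> {}" if t: "t \<subseteq> F" "finite t" "card t \<le> DIM('a) + 1" for t
  proof (cases "t = {}")
    case False
    show ?thesis
    proof
      assume e: "\<Inter>t = {}"
      have SM: "S \<in> sets M" if "S \<in> t" for S using that t by (auto simp: F_def compact_imp_closed)
      have mS: "measure M (D - S) < measure M D / ?d" if "S \<in> t" for S
      proof -
        have "measure M (D - S) = measure M D - measure M (D \<inter> S)"
          using finite_measure_Diff'[OF DM SM[OF that]] .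
        moreover have "?d * (measure M D - measure M (D \<inter> S)) < measure M D" 
          using that t by (auto simp: F_def)
        ultimately have "?d * measure M (D - S) < measure M D" by simp
        then show ?thesis by (simp add: pos_less_divide_eq mult.commute del: of_nat_add)
      qed
      have "D = (\<Union>S\<in>t. D - S)" using e by blast
      then have "measure M D \<le> (\<Sum>S\<in>t. measure M (D - S))"
        using finite_measure_subadditive_finite[of t "\<lambda>S. D - S"] t(2) SM DM by auto
      also have "\<dots> < (\<Sum>S\<in>t. measure M D / ?d)"
        using mS t(2) False by (intro sum_strict_mono) auto
      also have "\<dots> = real (card t) * (measure M D / ?d)" by simp
      also have "\<dots> \<le> ?d * (measure M D / ?d)"
        using t(3) pos by (intro mult_right_mono) auto
      also have "\<dots> = measure M D" by simp
      finally show False by simp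
    qed
  qed auto
  have fip: "\<Inter>t \<noteq> {}" if t: "t \<subseteq> F" "finite t" for t
  proof (cases "card t \<le> DIM('a) + 1")
    case False
    show ?thesis
    proof (rule Helly)
      show "\<Inter>u \<noteq> {}" if "u \<subseteq> t" "card u = DIM('a) + 1" for u
        using that t small[of u] finite_subset[of u t] by auto
      show "DIM('a) + 1 \<le> card t" using False by simp
      show "\<forall>s\<in>t. convex s" using t by (auto simp: F_def)
    qed
  qed (use t small in auto)
  \<comment> \<open>Continuity from below: an increasing exhaustion of a large set reaches \<open>F\<close>.\<close>
  have large: "\<exists>n. T n \<in> F"
    if T: "incseq T" "\<And>n. compact (T n)" "\<And>n. convex (T n)"
      "?d * (measure M D - measure M (D \<inter> (\<Union>n. T n))) < measure M D" for T :: "nat \<Rightarrow> 'a set"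
  proof -
    have TM: "T n \<in> sets M" for n using T(2) by (simp add: compact_imp_closed)
    have "(\<lambda>n. measure M (D \<inter> T n)) \<longlonglongrightarrow> measure M (\<Union>n. D \<inter> T n)"
      using T(1) TM DM by (intro finite_Lim_measure_incseq) (auto simp: incseq_def)
    then have "(\<lambda>n. ?d * (measure M D - measure M (D \<inter> T n))) \<longlonglongrightarrow> 
        ?d * (measure M D - measure M (\<Union>n. D \<inter> T n))"
      by (intro tendsto_intros)
    moreover have "(\<Union>n. D \<inter> T n) = D \<inter> (\<Union>n. T n)" by blast
    ultimately have "\<forall>\<^sub>F n in sequentially. ?d * (measure M D - measure M (D \<inter> T n)) < measure M D"
      using T(4) order_tendstoD(2) by metis
    then obtain n where "?d * (measure M D - measure M (D \<inter> T n)) < measure M D"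
      by (auto simp: eventually_sequentially)
    then show ?thesis using T by (auto simp: F_def)
  qed
  have un: "(\<Union>n. cball (0::'a) (real n)) = UNIV"
    by (auto simp: real_arch_simple)
  have "\<exists>n. cball (0::'a) (real n) \<in> F"
    using pos by (intro large) (auto simp: incseq_def un)
  then obtain S0 where S0: "S0 \<in> F" by blast
  have "S0 \<inter> \<Inter>F \<noteq> {}"
  proof (rule compact_imp_fip)
    show "compact S0" using S0 by (simp add: F_def)
    show "S0 \<inter> \<Inter>t \<noteq> {}" if "finite t" "t \<subseteq> F" for t
      using fip[of "insert S0 t"] that S0 by auto
  qed (auto simp: F_def compact_imp_closed)
  then obtain c where c: "\<And>S. S \<in> F \<Longrightarrow> c \<in> S" by blast
  have "measure M D \<le> ?d * measure M (D \<inter> {x. a \<bullet> x \<le> a \<bullet> c})" for a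
  proof (rule ccontr)
    assume contr: "\<not> ?thesis"
    \<comment> \<open>Otherwise the open half-space beyond \<open>c\<close> is large, and is exhausted by compact convex sets without \<open>c\<close>.\<close>
    define T where "T n = {x. a \<bullet> x \<ge> a \<bullet> c + 1 / (real n + 1)} \<inter> cball 0 (real n)" for n
    have T_un: "(\<Union>n. T n) = {x. a \<bullet> x > a \<bullet> c}"
    proof (intro set_eqI iffI)
      fix x assume "x \<in> (\<Union>n. T n)"
      then obtain n where "a \<bullet> x \<ge> a \<bullet> c + 1 / (real n + 1)" by (auto simp: T_def)
      moreover have "1 / (real n + 1) > 0" by simp
      ultimately show "x \<in> {x. a \<bullet> x > a \<bullet> c}" unfolding mem_Collect_eq by linarith
    next
      fix x assume "x \<in> {x. a \<bullet> x > a \<bullet> c}"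
      then have e: "a \<bullet> x - a \<bullet> c > 0" by simp
      obtain n1 where n1: "1 / (a \<bullet> x - a \<bullet> c) < real n1" using reals_Archimedean2 by blast
      obtain n2 where n2: "norm x \<le> real n2" using real_arch_simple by blast
      define n where "n = max n1 n2"
      have "1 / (a \<bullet> x - a \<bullet> c) < real n + 1" using n1 by (simp add: n_def)
      then have "1 / (real n + 1) < a \<bullet> x - a \<bullet> c" using e by (simp add: field_simps)
      moreover have "norm x \<le> real n" using n2 by (simp add: n_def)
      ultimately show "x \<in> (\<Union>n. T n)" by (auto simp: T_def intro!: exI[of _ n])
    qed
    have "\<exists>n. T n \<in> F"
    proof (rule large)
      show "incseq T"
      proof (intro incseq_SucI subsetI)
        fix n x assume "x \<in> T n"
        moreover have "1 / (real (Suc n) + 1) \<le> 1 / (real n + 1)" by (simp add: frac_le)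
        ultimately show "x \<in> T (Suc n)" by (auto simp: T_def)
      qed
      show "compact (T n)" for n unfolding T_def
        by (intro closed_Int_compact closed_halfspace_ge compact_cball)
      show "convex (T n)" for n unfolding T_def
        by (intro convex_Int convex_halfspace_ge convex_cball)
      have "D \<inter> {x. a \<bullet> x > a \<bullet> c} = D - D \<inter> {x. a \<bullet> x \<le> a \<bullet> c}" by auto
      moreover have "D \<inter> {x. a \<bullet> x \<le> a \<bullet> c} \<in> sets M"
        using D by (intro closed_sets closed_Int closed_halfspace_le)
      ultimately have "measure M (D \<inter> {x. a \<bullet> x > a \<bullet> c}) =
          measure M D - measure M (D \<inter> {x. a \<bullet> x \<le> a \<bullet> c})"
        using DM by (simp add: finite_measure_Diff)
      then show "?d * (measure M D - measure M (D \<inter> (\<Union>n. T n))) < measure M D"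
        using contr unfolding T_un by simp
    qed
    then obtain n where "c \<in> T n" using c by blast
    then have "c \<in> {x. a \<bullet> x > a \<bullet> c}" using T_un by blast
    then show False by simp
  qed
  then show ?thesis by blast
qed

section \<open>Carving tiles out of a convex set\<close>

text \<open>
  \<open>D\<close> is a tile of some tiling of \<open>C\<close> that has at most \<open>r\<close> further tiles.
\<close>

definition carve :: "nat \<Rightarrow> 'a set \<Rightarrow> 'a set \<Rightarrow> bool" where
  "carve r C D \<longleftrightarrow> (\<exists>P. tiling C P \<and> D \<in> P \<and> card P \<le> Suc r)"

lemma carve_self: "tile j D \<Longrightarrow> carve 0 D D"
  unfolding carve_def using tiling_self by fastforce

lemma carve_tile: "carve r C D \<Longrightarrow> \<exists>j. tile j D"
  by (auto simp: carve_def tiling_def)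

lemma carve_subset: "carve r C D \<Longrightarrow> D \<subseteq> C"
  by (auto simp: carve_def tiling_def)

lemma carve_trans:
  assumes "carve r C D" "carve s D E"
  shows "carve (r + s) C E"
proof -
  obtain P Q where P: "tiling C P" "D \<in> P" "card P \<le> Suc r" and Q: "tiling D Q" "E \<in> Q" "card Q \<le> Suc s"
    using assms by (auto simp: carve_def)
  define R where "R F = (if F = D then Q else {F})" for F
  have "tiling C (\<Union>F\<in>P. R F)"
    using P Q by (intro tiling_refine) (auto simp: R_def tiling_def)
  moreover have "(\<Union>F\<in>P. R F) = Q \<union> (P - {D})"
    using P(2) by (auto simp: R_def)
  moreover have "card (Q \<union> (P - {D})) \<le> card Q + card (P - {D})" by (rule card_Un_le)
  moreover have "card (P - {D}) = card P - 1" using P by (simp add: tiling_def)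
  ultimately show ?thesis
    using P Q unfolding carve_def by (intro exI[of _ "Q \<union> (P - {D})"]) auto
qed

text \<open>
  If a half-space contains more than one unit of \<open>D\<close>, then moving its boundary hyperplane inwards,
  at the cost of at most one unit, makes the part of \<open>D\<close> inside it a tile.
\<close>

lemma carve_halfspace:
  assumes D: "tile n D" and a: "a \<noteq> 0" and K: "1 < K"
    and big: "K * w \<le> measure M (D \<inter> {x. a \<bullet> x \<le> b})"
  shows "\<exists>E. carve 1 D E \<and> E \<subseteq> {x. a \<bullet> x \<le> b} \<and> (K - 1) * w \<le> measure M E"
proof -
  \<comment> \<open>The largest integer strictly below \<open>K\<close>: strictness leaves a remainder of positive measure.\<close>
  define j where "j = nat (\<lceil>K\<rceil> - 1)"
  have j: "0 < j" "real j < K" "K - 1 \<le> real j"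
    using K by (simp_all add: j_def) linarith+
  have cl: "closed D" using D by (simp add: tile_def)
  have "measure M (D \<inter> {x. a \<bullet> x \<le> b}) \<le> measure M D"
    using cl by (intro finite_measure_mono) auto
  then have "K * w \<le> real n * w" using big D by (simp add: tile_def)
  then have "j < n" using w_pos j by simp
  then obtain b' where t: "tile j (D \<inter> {x. a \<bullet> x \<le> b'})"
    and tl: "tiling D {D \<inter> {x. a \<bullet> x \<le> b'}, D \<inter> {x. a \<bullet> x \<ge> b'}}"
    using halfspace_cut[OF D a \<open>0 < j\<close>] by blast
  define E where "E = D \<inter> {x. a \<bullet> x \<le> b'}"
  have mE: "measure M E = real j * w" using t by (simp add: tile_def E_def)
  have "b' \<le> b"
  proof (rule ccontr)
    assume "\<not> b' \<le> b"
    then have "measure M (D \<inter> {x. a \<bullet> x \<le> b}) \<le> measure M E"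
      unfolding E_def using cl by (intro finite_measure_mono) (auto intro!: closed_sets closed_halfspace_le)
    then have "K * w \<le> real j * w" using big mE by simp
    then show False using j w_pos by simp
  qed
  then have "E \<subseteq> {x. a \<bullet> x \<le> b}" by (auto simp: E_def)
  moreover have "carve 1 D E"
    unfolding carve_def E_def using tl
    by (intro exI[of _ "{D \<inter> {x. a \<bullet> x \<le> b'}, D \<inter> {x. a \<bullet> x \<ge> b'}}"]) (auto simp: card_insert_if)
  moreover have "(K - 1) * w \<le> measure M E" using mE j w_pos by simp
  ultimately show ?thesis by blast
qed

end

section \<open>A tiling with a large tile missed by each hyperplane\<close>

text \<open>
  The constants of the construction in dimension \<open>d\<close>. A cut that separates \<open>d + 1\<close> tiles retains at
  least the fraction \<open>shrink d\<close> of each of them: a centerpoint gives \<open>1 / (d + 1)\<close>, and half of this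
  is sacrificed to absorb the lost unit. After one cut for each of the \<open>2 ^ (d + 1)\<close> index sets,
  every hyperplane misses at least the fraction \<open>missed d\<close> of the whole, because each of the
  \<open>d + 1\<close> initial slabs carries at least \<open>1 / (2 * (d + 2))\<close> of it (rounding to integral measures
  included). The \<open>pieces d\<close> tiles are the remainder left by the slabs and, for each slab, at most one
  more than the number of cuts.
\<close>

definition shrink :: "nat \<Rightarrow> real" where
  "shrink d = 1 / (2 * (real d + 1))"

definition missed :: "nat \<Rightarrow> real" where
  "missed d = shrink d ^ (2 ^ (d + 1)) / (2 * (real d + 2))"

definition pieces :: "nat \<Rightarrow> nat" where
  "pieces d = 1 + (d + 1) * (2 ^ (d + 1) + 1)"

lemma shrink_bounds: "0 < shrink d" "shrink d \<le> 1"
  by (simp_all add: shrink_def field_simps)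

lemma missed_bounds: "0 < missed d" "missed d \<le> 1 / (2 * (real d + 2))" "missed d < 1"
proof -
  show "0 < missed d" using shrink_bounds[of d] by (simp add: missed_def)
  have "shrink d ^ (2 ^ (d + 1)) \<le> 1" using shrink_bounds[of d] by (intro power_le_one) auto
  then show *: "missed d \<le> 1 / (2 * (real d + 2))"
    unfolding missed_def by (intro divide_right_mono) auto
  have "1 / (2 * (real d + 2)) < 1" by (simp add: field_simps)
  with * show "missed d < 1" by linarith
qed

context unit_measure
begin

text \<open>
  An approximate ham-sandwich cut. The hyperplane passes through centerpoints of \<open>Y 0, \<dots>, Y (d - 1)\<close>,
  so both of its sides contain a substantial part of each of these. The remaining tile \<open>Y d\<close> has at
  least half of its measure on one side, and this fixes the orientation.
\<close>

lemma separate_step: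
  fixes Y :: "nat \<Rightarrow> 'a set"
  assumes Y: "\<And>i. i \<le> DIM('a) \<Longrightarrow> \<exists>n. tile n (Y i)"
    and mY: "\<And>i. i \<le> DIM('a) \<Longrightarrow> K * w \<le> measure M (Y i)"
    and K: "1 \<le> shrink DIM('a) * K"
  shows "\<exists>Z. (\<forall>i\<le>DIM('a). carve 1 (Y i) (Z i) \<and> shrink DIM('a) * K * w \<le> measure M (Z i)) \<and> separated Z J"
proof -
  let ?d = "DIM('a)"
  have cl: "closed (Y i)" if "i \<le> ?d" for i using Y[OF that] by (auto simp: tile_def)
  have "\<forall>i. \<exists>c. i \<le> ?d \<longrightarrow> (\<forall>a. measure M (Y i) \<le> real (?d + 1) * measure M (Y i \<inter> {x. a \<bullet> x \<le> a \<bullet> c}))"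
    using centerpoint cl by blast
  then obtain c where c: "\<And>i a. i \<le> ?d \<Longrightarrow> measure M (Y i) \<le> real (?d + 1) * measure M (Y i \<inter> {x. a \<bullet> x \<le> a \<bullet> c i})"
    by metis
  obtain a b where a: "a \<noteq> 0" and ac: "\<And>i. i < ?d \<Longrightarrow> a \<bullet> c i = b"
    using hyperplane_through_points[of c] by blast
  define sg :: "nat \<Rightarrow> real" where "sg i = (if i \<in> J then 1 else -1)" for i
  define G where "G t = Y ?d \<inter> {x. (t *\<^sub>R a) \<bullet> x \<le> t * b}" for t :: real
  have Gcl: "closed (G t)" for t
    unfolding G_def using cl[of ?d] by (intro closed_Int closed_halfspace_le) auto
  have "Y ?d = G 1 \<union> G (-1)" by (auto simp: G_def)
  then have "measure M (Y ?d) \<le> measure M (G 1) + measure M (G (-1))"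
    using Gcl by (metis closed_sets measure_Un_le)
  then have "measure M (Y ?d) \<le> 2 * measure M (G 1) \<or> measure M (Y ?d) \<le> 2 * measure M (G (-1))"
    by linarith
  then obtain t0 :: real where t0: "t0 = 1 \<or> t0 = -1" and "measure M (Y ?d) \<le> 2 * measure M (G t0)"
    by blast
  moreover have "2 * measure M (G t0) \<le> real (?d + 1) * measure M (G t0)"
    using DIM_positive[where 'a='a] by (intro mult_right_mono) auto
  ultimately have last: "measure M (Y ?d) \<le> real (?d + 1) * measure M (G t0)" by linarith
  \<comment> \<open>Multiplying the functional by \<open>t\<close> turns the larger part of \<open>Y d\<close> towards the side that \<open>J\<close> prescribes.\<close>
  define t where "t = sg ?d * t0"
  have t: "t = 1 \<or> t = -1" using t0 by (auto simp: t_def sg_def)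
  have part: "measure M (Y i) \<le> real (?d + 1) * measure M (Y i \<inter> {x. ((sg i * t) *\<^sub>R a) \<bullet> x \<le> sg i * t * b})"
    if i: "i \<le> ?d" for i
  proof (cases "i = ?d")
    case True
    have "sg i * t = t0" by (simp add: t_def sg_def True)
    then show ?thesis using last True by (simp add: G_def)
  next
    case False
    then show ?thesis using c[OF i, of "(sg i * t) *\<^sub>R a"] ac[of i] i by simp
  qed
  have "\<exists>E. carve 1 (Y i) E \<and> E \<subseteq> {x. ((sg i * t) *\<^sub>R a) \<bullet> x \<le> sg i * t * b} \<and> shrink ?d * K * w \<le> measure M E"
    if i: "i \<le> ?d" for i
  proof -
    obtain n where n: "tile n (Y i)" using Y[OF i] by blast
    have 2: "K / (real ?d + 1) = 2 * (shrink ?d * K)" by (simp add: shrink_def field_simps)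
    have "K * w \<le> real (?d + 1) * measure M (Y i \<inter> {x. ((sg i * t) *\<^sub>R a) \<bullet> x \<le> sg i * t * b})"
      using mY[OF i] part[OF i] by linarith
    then have "K / (real ?d + 1) * w \<le> measure M (Y i \<inter> {x. ((sg i * t) *\<^sub>R a) \<bullet> x \<le> sg i * t * b})"
      by (simp add: divide_le_eq mult.commute add.commute)
    moreover have "(sg i * t) *\<^sub>R a \<noteq> 0" using a t by (auto simp: sg_def)
    ultimately obtain E where E: "carve 1 (Y i) E" "E \<subseteq> {x. ((sg i * t) *\<^sub>R a) \<bullet> x \<le> sg i * t * b}"
      "(K / (real ?d + 1) - 1) * w \<le> measure M E"
      using carve_halfspace[OF n, of "(sg i * t) *\<^sub>R a" "K / (real ?d + 1)" "sg i * t * b"] 2 K by auto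
    have "shrink ?d * K * w \<le> (K / (real ?d + 1) - 1) * w"
      unfolding 2 using K w_pos by (intro mult_right_mono) linarith+
    then show ?thesis using E by (intro exI[of _ E]) auto
  qed
  then obtain Z where Z: "\<And>i. i \<le> ?d \<Longrightarrow> carve 1 (Y i) (Z i) \<and>
      Z i \<subseteq> {x. ((sg i * t) *\<^sub>R a) \<bullet> x \<le> sg i * t * b} \<and> shrink ?d * K * w \<le> measure M (Z i)"
    by metis
  have "separated Z J"
    unfolding separated_def
  proof (intro exI[of _ "t *\<^sub>R a"] exI[of _ "t * b"] conjI allI impI)
    show "t *\<^sub>R a \<noteq> 0" using t a by auto
    show "Z i \<subseteq> (if i \<in> J then {x. t *\<^sub>R a \<bullet> x \<le> t * b} else {x. t * b \<le> t *\<^sub>R a \<bullet> x})"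
      if "i \<le> ?d" for i
      using Z[OF that] by (auto simp: sg_def)
  qed
  then show ?thesis using Z by blast
qed

lemma separate_all:
  fixes Y :: "nat \<Rightarrow> 'a set"
  assumes fin: "finite \<J>"
    and Y: "\<And>i. i \<le> DIM('a) \<Longrightarrow> \<exists>n. tile n (Y i)"
    and mY: "\<And>i. i \<le> DIM('a) \<Longrightarrow> K * w \<le> measure M (Y i)"
    and K: "1 \<le> shrink DIM('a) ^ card \<J> * K"
  shows "\<exists>Z. (\<forall>i\<le>DIM('a). carve (card \<J>) (Y i) (Z i) \<and>
                shrink DIM('a) ^ card \<J> * K * w \<le> measure M (Z i)) \<and>
             (\<forall>J\<in>\<J>. separated Z J)"
  using fin K
proof (induction \<J>)
  case empty
  have "carve 0 (Y i) (Y i)" if "i \<le> DIM('a)" for i using Y[OF that] carve_self by blast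
  then show ?case using mY by (intro exI[of _ Y]) auto
next
  case (insert J \<J>)
  let ?q = "shrink DIM('a)" and ?r = "card \<J>"
  have K': "1 \<le> ?q * (?q ^ ?r * K)" using insert by (simp add: mult.assoc)
  then have "0 \<le> ?q ^ ?r * K"
    using shrink_bounds[of "DIM('a)"] by (smt (verit) mult_nonneg_nonpos)
  then have "?q * (?q ^ ?r * K) \<le> ?q ^ ?r * K"
    using shrink_bounds[of "DIM('a)"] mult_right_mono[of ?q 1 "?q ^ ?r * K"] by simp
  then have "1 \<le> ?q ^ ?r * K" using K' by linarith
  then obtain Z where Z: "\<And>i. i \<le> DIM('a) \<Longrightarrow> carve ?r (Y i) (Z i) \<and> ?q ^ ?r * K * w \<le> measure M (Z i)"
    and sep: "\<forall>J\<in>\<J>. separated Z J"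
    using insert.IH by blast
  obtain Z' where Z': "\<And>i. i \<le> DIM('a) \<Longrightarrow> carve 1 (Z i) (Z' i) \<and> ?q * (?q ^ ?r * K) * w \<le> measure M (Z' i)"
    and sep': "separated Z' J"
    using separate_step[of Z "?q ^ ?r * K" J] Z carve_tile K' by blast
  have "carve (card (insert J \<J>)) (Y i) (Z' i) \<and> ?q ^ card (insert J \<J>) * K * w \<le> measure M (Z' i)"
    if "i \<le> DIM('a)" for i
    using carve_trans[of ?r "Y i" "Z i" 1 "Z' i"] Z[OF that] Z'[OF that] insert.hyps by (simp add: mult.assoc)
  moreover have "separated Z' J'" if "J' \<in> \<J>" for J'
    using separated_mono[of Z J' Z'] sep that Z' carve_subset by blast
  ultimately show ?case using sep' by blast
qed

text \<open>
  Starting from \<open>d + 1\<close> equal slabs and a remainder, the slabs are shrunk until they are separated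
  for every index set. All that is cut off stays in the tiling as further tiles.
\<close>

lemma tiling_every_hyperplane_misses:
  assumes C: "tile N C" and N: "1 \<le> missed DIM('a) * real N"
  shows "\<exists>P. tiling C P \<and> card P \<le> pieces DIM('a) \<and>
     (\<forall>H. is_hyperplane H \<longrightarrow> (\<exists>D\<in>P. avoids H D \<and> missed DIM('a) * real N * w \<le> measure M D))"
proof -
  let ?d = "DIM('a)" and ?s = "2 ^ (DIM('a) + 1) :: nat"
  define k where "k = N div (?d + 2)"
  have "missed ?d * real N \<le> real N / (2 * (real ?d + 2))"
    using mult_right_mono[OF missed_bounds(2)[of ?d], of "real N"] by simp
  then have "1 \<le> real N / (2 * (real ?d + 2))" using N order_trans by blast
  then have Nd: "2 * (real ?d + 2) \<le> real N" by (simp add: pos_le_divide_eq)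
  have "N < (k + 1) * (?d + 2)"
    using dividend_less_div_times[of "?d + 2" N] by (simp add: k_def algebra_simps)
  then have "real N < real ((k + 1) * (?d + 2))" by (simp only: of_nat_less_iff)
  also have "\<dots> = (real k + 1) * (real ?d + 2)" by (simp only: of_nat_mult of_nat_add of_nat_1 of_nat_numeral)
  finally have N_less: "real N < (real k + 1) * (real ?d + 2)" .
  define x where "x = real N / (real ?d + 2)"
  have "x < real k + 1" using N_less by (simp add: x_def pos_divide_less_eq)
  moreover have "2 \<le> x" using Nd by (simp add: x_def pos_le_divide_eq)
  ultimately have "x / 2 \<le> real k" by linarith
  then have k_ge: "real N / (2 * (real ?d + 2)) \<le> real k" by (simp add: x_def mult.commute)
  have k_pos: "0 < k"
  proof (rule ccontr)
    assume "\<not> 0 < k"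
    then show False using \<open>1 \<le> real N / (2 * (real ?d + 2))\<close> k_ge by simp
  qed
  have big: "missed ?d * real N \<le> shrink ?d ^ ?s * real k"
  proof -
    have "missed ?d * real N = shrink ?d ^ ?s * (real N / (2 * (real ?d + 2)))" by (simp add: missed_def)
    also have "\<dots> \<le> shrink ?d ^ ?s * real k"
      using k_ge shrink_bounds[of ?d] by (intro mult_left_mono) auto
    finally show ?thesis .
  qed
  have "(?d + 2) * k \<le> N" unfolding k_def by (rule times_div_less_eq_dividend)
  then have "(?d + 1) * k < N" using k_pos by simp
  then obtain S R where tl: "tiling C (insert R S)" and S: "R \<notin> S" "finite S" "card S = ?d + 1"
    "\<forall>D\<in>S. tile k D"
    using slabs[OF C k_pos] by blast
  obtain Y where Y: "bij_betw Y {..?d} S"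
    using finite_same_card_bij[of "{..?d}" S] S by auto
  then have YS: "Y i \<in> S" if "i \<le> ?d" for i using that by (auto simp: bij_betw_def)
  have card_Pow': "card (Pow {..?d}) = ?s" by (simp add: card_Pow)
  have "\<exists>Z. (\<forall>i\<le>?d. carve (card (Pow {..?d})) (Y i) (Z i) \<and>
                shrink ?d ^ card (Pow {..?d}) * real k * w \<le> measure M (Z i)) \<and>
             (\<forall>J\<in>Pow {..?d}. separated Z J)"
  proof (rule separate_all)
    show "\<exists>n. tile n (Y i)" if "i \<le> ?d" for i using YS[OF that] S by blast
    show "real k * w \<le> measure M (Y i)" if "i \<le> ?d" for i using YS[OF that] S by (simp add: tile_def)
    show "1 \<le> shrink ?d ^ card (Pow {..?d}) * real k" unfolding card_Pow' using big N by linarith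
  qed simp
  then obtain Z where Z: "\<And>i. i \<le> ?d \<Longrightarrow> carve ?s (Y i) (Z i)"
      "\<And>i. i \<le> ?d \<Longrightarrow> shrink ?d ^ ?s * real k * w \<le> measure M (Z i)"
    and sep: "\<And>J. J \<subseteq> {..?d} \<Longrightarrow> separated Z J"
    unfolding card_Pow' by blast
  have "\<forall>i. \<exists>Q. i \<le> ?d \<longrightarrow> tiling (Y i) Q \<and> Z i \<in> Q \<and> card Q \<le> Suc ?s"
    using Z(1) unfolding carve_def by blast
  then obtain Q where Q: "\<And>i. i \<le> ?d \<Longrightarrow> tiling (Y i) (Q i)" "\<And>i. i \<le> ?d \<Longrightarrow> Z i \<in> Q i"
    "\<And>i. i \<le> ?d \<Longrightarrow> card (Q i) \<le> Suc ?s"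
    by metis
  define T where "T D = (if D = R then {R} else Q (the_inv_into {..?d} Y D))" for D
  have inv: "the_inv_into {..?d} Y (Y i) = i" if "i \<le> ?d" for i
    using that Y by (intro the_inv_into_f_f) (auto simp: bij_betw_def)
  have TY: "T (Y i) = Q i" if "i \<le> ?d" for i using YS[OF that] S(1) inv[OF that] by (auto simp: T_def)
  have SY: "S = Y ` {..?d}" using Y by (simp add: bij_betw_def)
  have "tiling C (\<Union>D\<in>insert R S. T D)"
  proof (rule tiling_refine[OF tl])
    fix D assume "D \<in> insert R S"
    then consider "D = R" | i where "i \<le> ?d" "D = Y i" using SY by auto
    then show "tiling D (T D)"
    proof cases
      case 1
      have "\<exists>j. tile j R" using tl by (auto simp: tiling_def)
      then show ?thesis using 1 tiling_self by (auto simp: T_def)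
    next
      case 2
      then show ?thesis using Q(1) TY by simp
    qed
  qed
  moreover have "(\<Union>D\<in>insert R S. T D) = insert R (\<Union>i\<in>{..?d}. Q i)"
  proof -
    have "(\<Union>D\<in>S. T D) = (\<Union>i\<in>{..?d}. T (Y i))" unfolding SY by blast
    also have "\<dots> = (\<Union>i\<in>{..?d}. Q i)" using TY by (intro SUP_cong refl) simp
    finally have "(\<Union>D\<in>S. T D) = (\<Union>i\<in>{..?d}. Q i)" .
    moreover have "T R = {R}" by (simp add: T_def)
    ultimately show ?thesis by simp
  qed
  ultimately have tiled: "tiling C (insert R (\<Union>i\<in>{..?d}. Q i))" by simp
  have "card (insert R (\<Union>i\<in>{..?d}. Q i)) \<le> 1 + card (\<Union>i\<in>{..?d}. Q i)"
    using card_Un_le[of "{R}" "\<Union>i\<in>{..?d}. Q i"] by simp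
  also have "card (\<Union>i\<in>{..?d}. Q i) \<le> (\<Sum>i\<le>?d. card (Q i))" by (intro card_UN_le) simp
  also have "\<dots> \<le> (\<Sum>i\<le>?d. Suc ?s)" using Q(3) by (intro sum_mono) auto
  finally have "card (insert R (\<Union>i\<in>{..?d}. Q i)) \<le> pieces ?d" by (simp add: pieces_def)
  moreover have "\<exists>i\<le>?d. avoids H (Z i)" if "is_hyperplane H" for H
  proof (rule no_hyperplane_transversal[OF sep _ that])
    fix i j assume ij: "i \<le> ?d" "j \<le> ?d" "i \<noteq> j"
    then have "Y i \<noteq> Y j" using Y by (auto simp: bij_betw_def inj_on_def)
    then have "interior (Y i) \<inter> interior (Y j) = {}"
      using tl YS ij by (auto simp: tiling_def pairwise_def)
    then show "interior (Z i) \<inter> interior (Z j) = {}"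
      using interior_mono[of "Z i" "Y i"] interior_mono[of "Z j" "Y j"] Z(1) ij carve_subset by blast
  qed
  moreover have "missed ?d * real N * w \<le> measure M (Z i)" if "i \<le> ?d" for i
    using Z(2)[OF that] big w_pos mult_right_mono[OF big, of w] by linarith
  moreover have "Z i \<in> insert R (\<Union>i\<in>{..?d}. Q i)" if "i \<le> ?d" for i using Q(2) that by blast
  ultimately show ?thesis using tiled by (intro exI[of _ "insert R (\<Union>i\<in>{..?d}. Q i)"]) blast
qed

section \<open>Tilings with few crossed units\<close>

text \<open>
  Iteration to depth \<open>t\<close>. Below the size at which a tile can still be subdivided in the way of the
  previous lemma it consists of at most \<open>1 / missed d\<close> units; the additive term bounds the number of
  crossed units in such tiles.
\<close>

lemma unit_tiling_few_crossed:
  assumes "tile N C"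
  shows "\<exists>P. tiling C P \<and> (\<forall>D\<in>P. tile 1 D) \<and>
     (\<forall>H. is_hyperplane H \<longrightarrow> real (card {D\<in>P. \<not> avoids H D}) \<le>
        (1 - missed DIM('a)) ^ t * real N + real (pieces DIM('a)) ^ t / missed DIM('a))"
  using assms
proof (induction t arbitrary: N C)
  case 0
  obtain P where P: "tiling C P" "\<forall>D\<in>P. tile 1 D" using unit_tiling_exists[OF 0] by blast
  have "real (card {D\<in>P. \<not> avoids H D}) \<le> real N + 1 / missed DIM('a)" for H
  proof -
    have "card {D\<in>P. \<not> avoids H D} \<le> card P" using P by (intro card_mono) (auto simp: tiling_def)
    moreover have "0 < 1 / missed DIM('a)" using missed_bounds by simp
    ultimately show ?thesis using unit_tiling_card[OF 0 P] by linarith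
  qed
  then show ?case using P by auto
next
  case (Suc t)
  let ?\<delta> = "missed DIM('a)" and ?L = "real (pieces DIM('a))"
  have \<delta>: "0 < ?\<delta>" "?\<delta> < 1" using missed_bounds by auto
  have L: "1 \<le> ?L" by (simp add: pieces_def)
  show ?case
  proof (cases "1 \<le> ?\<delta> * real N")
    case False
    obtain P where P: "tiling C P" "\<forall>D\<in>P. tile 1 D" using unit_tiling_exists[OF Suc.prems] by blast
    have "real (card {D\<in>P. \<not> avoids H D}) \<le> (1 - ?\<delta>) ^ Suc t * real N + ?L ^ Suc t / ?\<delta>" for H
    proof -
      have "card {D\<in>P. \<not> avoids H D} \<le> card P" using P by (intro card_mono) (auto simp: tiling_def)
      moreover have "real N \<le> 1 / ?\<delta>" using False \<delta> by (simp add: field_simps)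
      moreover have "1 / ?\<delta> \<le> ?L ^ Suc t / ?\<delta>"
        using \<delta> L one_le_power[OF L, of "Suc t"] by (intro divide_right_mono) auto
      moreover have "0 \<le> (1 - ?\<delta>) ^ Suc t * real N" using \<delta> by simp
      ultimately show ?thesis using unit_tiling_card[OF Suc.prems P] by linarith
    qed
    then show ?thesis using P by blast
  next
    case True
    obtain P where P: "tiling C P" "card P \<le> pieces DIM('a)"
      and miss: "\<And>H. is_hyperplane H \<Longrightarrow> \<exists>D\<in>P. avoids H D \<and> ?\<delta> * real N * w \<le> measure M D"
      using tiling_every_hyperplane_misses[OF Suc.prems True] by blast
    have finP: "finite P" using P by (simp add: tiling_def)
    obtain n where n: "\<And>D. D \<in> P \<Longrightarrow> tile (n D) D" using P unfolding tiling_def by metis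
    have mD: "measure M D = real (n D) * w" if "D \<in> P" for D using n[OF that] by (simp add: tile_def)
    have "real N * w = (\<Sum>D\<in>P. real (n D)) * w"
      using measure_tiling[OF P(1)] mD Suc.prems by (simp add: tile_def sum_distrib_right)
    then have sum_n: "(\<Sum>D\<in>P. real (n D)) = real N" using w_pos by simp
    have "\<forall>D\<in>P. \<exists>Q. tiling D Q \<and> (\<forall>E\<in>Q. tile 1 E) \<and>
        (\<forall>H. is_hyperplane H \<longrightarrow> real (card {E\<in>Q. \<not> avoids H E}) \<le>
          (1 - ?\<delta>) ^ t * real (n D) + ?L ^ t / ?\<delta>)"
      using Suc.IH n by blast
    from bchoice[OF this]
    obtain Q where Q: "\<And>D. D \<in> P \<Longrightarrow> tiling D (Q D)" "\<And>D E. D \<in> P \<Longrightarrow> E \<in> Q D \<Longrightarrow> tile 1 E"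
      and crossed: "\<And>D H. D \<in> P \<Longrightarrow> is_hyperplane H \<Longrightarrow> real (card {E\<in>Q D. \<not> avoids H E}) \<le>
        (1 - ?\<delta>) ^ t * real (n D) + ?L ^ t / ?\<delta>"
      by blast
    have tl: "tiling C (\<Union>D\<in>P. Q D)" using tiling_refine[OF P(1)] Q(1) by blast
    have "real (card {E\<in>(\<Union>D\<in>P. Q D). \<not> avoids H E}) \<le> (1 - ?\<delta>) ^ Suc t * real N + ?L ^ Suc t / ?\<delta>"
      if H: "is_hyperplane H" for H
    proof -
      obtain D0 where D0: "D0 \<in> P" "avoids H D0" "?\<delta> * real N * w \<le> measure M D0" using miss[OF H] by blast
      have nD0: "?\<delta> * real N \<le> real (n D0)" using D0(3) w_pos by (simp add: mD[OF D0(1)])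
      have "avoids H E" if "E \<in> Q D0" for E
        using tiling_member[OF Q(1)[OF D0(1)] that] D0(2) interior_mono[of E D0] by (auto simp: avoids_def)
      then have "{E\<in>(\<Union>D\<in>P. Q D). \<not> avoids H E} \<subseteq> (\<Union>D\<in>P - {D0}. {E\<in>Q D. \<not> avoids H E})" by blast
      moreover have "finite (\<Union>D\<in>P - {D0}. {E\<in>Q D. \<not> avoids H E})"
        using finP Q(1) by (auto simp: tiling_def)
      ultimately have "card {E\<in>(\<Union>D\<in>P. Q D). \<not> avoids H E} \<le> card (\<Union>D\<in>P - {D0}. {E\<in>Q D. \<not> avoids H E})"
        by (intro card_mono)
      also have "\<dots> \<le> (\<Sum>D\<in>P - {D0}. card {E\<in>Q D. \<not> avoids H E})"
        using finP by (intro card_UN_le) simp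
      finally have "real (card {E\<in>(\<Union>D\<in>P. Q D). \<not> avoids H E}) \<le> (\<Sum>D\<in>P - {D0}. real (card {E\<in>Q D. \<not> avoids H E}))"
        unfolding of_nat_sum[symmetric] of_nat_le_iff .
      also have "\<dots> \<le> (\<Sum>D\<in>P - {D0}. (1 - ?\<delta>) ^ t * real (n D) + ?L ^ t / ?\<delta>)"
        using crossed H by (intro sum_mono) auto
      also have "\<dots> = (1 - ?\<delta>) ^ t * (\<Sum>D\<in>P - {D0}. real (n D)) + real (card (P - {D0})) * (?L ^ t / ?\<delta>)"
        by (simp add: sum.distrib sum_distrib_left)
      also have "(\<Sum>D\<in>P - {D0}. real (n D)) = real N - real (n D0)"
        using sum_n sum.remove[OF finP D0(1), of "\<lambda>D. real (n D)"] by simp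
      also have "(1 - ?\<delta>) ^ t * (real N - real (n D0)) \<le> (1 - ?\<delta>) ^ t * ((1 - ?\<delta>) * real N)"
        using nD0 \<delta> by (intro mult_left_mono) (auto simp: algebra_simps)
      also have "real (card (P - {D0})) * (?L ^ t / ?\<delta>) \<le> ?L * (?L ^ t / ?\<delta>)"
      proof (intro mult_right_mono)
        show "real (card (P - {D0})) \<le> ?L" using P(2) card_Diff1_le[of P D0] by linarith
      qed (use \<delta> L in auto)
      finally show ?thesis by (simp add: mult_ac)
    qed
    then show ?thesis using tl Q(2) by (intro exI[of _ "\<Union>D\<in>P. Q D"]) blast
  qed
qed

end

section \<open>The avoidance number\<close>

text \<open>
  The standard Gaussian measure, as a product over the coordinates.
\<close>

lemma nice_measure_exists: "\<exists>M :: 'a::euclidean_space measure. nice_measure M"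
proof -
  define f :: "'a \<Rightarrow> real" where "f x = (\<Prod>b\<in>Basis. std_normal_density (x \<bullet> b))" for x
  define M where "M = density lborel (\<lambda>x. ennreal (f x))"
  have fpos: "0 < f x" for x unfolding f_def by (intro prod_pos) (simp add: normal_density_pos)
  have cont: "continuous_on UNIV f"
    unfolding f_def normal_density_def by (intro continuous_intros) auto
  then have [measurable]: "f \<in> borel_measurable borel" by (rule borel_measurable_continuous_onI)
  have one: "(\<integral>\<^sup>+x. ennreal (std_normal_density x) \<partial>lborel) = 1"
    using prob_space.emeasure_space_1[OF prob_space_normal_density[of 1 0]]
    by (simp add: emeasure_density)
  have "emeasure M UNIV = (\<integral>\<^sup>+x. ennreal (f x) \<partial>lborel)"
    unfolding M_def by (simp add: emeasure_density)
  also have "\<dots> = (\<integral>\<^sup>+x. (\<Prod>b\<in>Basis. ennreal (std_normal_density (x \<bullet> b))) \<partial>(lborel :: 'a measure))"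
    unfolding f_def by (simp add: prod_ennreal)
  also have "\<dots> = (\<Prod>b\<in>(Basis :: 'a set). (\<integral>\<^sup>+x. ennreal (std_normal_density x) \<partial>lborel))"
    by (intro nn_integral_lborel_prod) auto
  also have "\<dots> = 1" using one by simp
  finally have tot: "emeasure M UNIV = 1" .
  have sM: "sets M = sets borel" by (simp add: M_def)
  then have "finite_measure M"
    using tot by (intro finite_measureI) (simp add: M_def)
  then have "nice_measure M"
    unfolding nice_measure_def using sM tot cont fpos M_def by auto
  then show ?thesis by blast
qed

text \<open>
  Goodness of \<open>n\<close> is a statement about all nice measures, so this needs that one exists.
\<close>

lemma good_number_ge:
  assumes "good_number TYPE('a::euclidean_space) k n"
  shows "k \<le> n"
proof -
  obtain M :: "'a measure" where M: "nice_measure M" using nice_measure_exists by blast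
  then obtain P :: "'a set set" where P: "convex_partition n P"
    and av: "\<And>H. is_hyperplane H \<Longrightarrow> k \<le> card {C \<in> P. avoids H C}"
    using assms unfolding good_number_def by blast
  obtain a :: 'a where a: "a \<noteq> 0" using nonzero_Basis SOME_Basis by blast
  then have "is_hyperplane {x. a \<bullet> x = 0}" unfolding is_hyperplane_def by blast
  then have "k \<le> card {C \<in> P. avoids {x. a \<bullet> x = 0} C}" by (rule av)
  also have "\<dots> \<le> card P" using P by (intro card_mono) (auto simp: convex_partition_def)
  finally show ?thesis using P by (simp add: convex_partition_def)
qed

lemma good_numberI:
  assumes n: "0 < n"
    and k: "real k + (1 - missed DIM('a)) ^ t * real n + real (pieces DIM('a)) ^ t / missed DIM('a) \<le> real n"
  shows "good_number TYPE('a::euclidean_space) k n"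
  unfolding good_number_def
proof (intro allI impI)
  fix M :: "'a measure"
  assume nice: "nice_measure M"
  then obtain f :: "'a \<Rightarrow> real" where f: "continuous_on UNIV f" "M = density lborel (\<lambda>x. ennreal (f x))"
    and M: "sets M = sets borel" "finite_measure M" "emeasure M UNIV \<noteq> 0"
    unfolding nice_measure_def by blast
  interpret finite_measure M by fact
  have [measurable]: "f \<in> borel_measurable borel" using f(1) by (rule borel_measurable_continuous_onI)
  have ac: "absolutely_continuous lborel M"
    unfolding f(2) by (intro absolutely_continuousI_density) simp
  have mU: "0 < measure M UNIV"
    using M(3) by (simp add: emeasure_eq_measure zero_less_measure_iff)
  interpret unit_measure M "measure M UNIV / real n"
    by unfold_locales (use M ac mU n in auto)
  have "tile n (UNIV :: 'a set)" using n by (simp add: tile_def)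
  from unit_tiling_few_crossed[OF this, of t] obtain P where P: "tiling UNIV P" "\<forall>D\<in>P. tile 1 D"
    and crossed: "\<And>H. is_hyperplane H \<Longrightarrow> real (card {D\<in>P. \<not> avoids H D}) \<le>
        (1 - missed DIM('a)) ^ t * real n + real (pieces DIM('a)) ^ t / missed DIM('a)"
    by blast
  have cP: "card P = n" by (rule unit_tiling_card[OF \<open>tile n UNIV\<close> P])
  have "convex_partition n P"
    using P cP tile_interior_nonempty unfolding convex_partition_def tiling_def tile_def by blast
  moreover have "emeasure M C = emeasure M D" if "C \<in> P" "D \<in> P" for C D
    using P(2) that by (simp add: tile_def emeasure_eq_measure)
  moreover have "k \<le> card {C \<in> P. avoids H C}" if "is_hyperplane H" for H
  proof -
    have fin: "finite P" using P by (simp add: tiling_def)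
    have "card P = card ({C \<in> P. avoids H C} \<union> {C \<in> P. \<not> avoids H C})"
      by (intro arg_cong[where f=card]) blast
    also have "\<dots> = card {C \<in> P. avoids H C} + card {C \<in> P. \<not> avoids H C}"
      using fin by (intro card_Un_disjoint) auto
    finally show ?thesis using crossed[OF that] k cP by linarith
  qed
  ultimately show "\<exists>P. convex_partition n P \<and> (\<forall>C\<in>P. \<forall>D\<in>P. emeasure M C = emeasure M D) \<and>
      (\<forall>H. is_hyperplane H \<longrightarrow> k \<le> card {C \<in> P. avoids H C})"
    by blast
qed

lemma eventually_good_number:
  assumes e: "0 < e" "e < 1"
  shows "\<forall>\<^sub>F n in sequentially. \<forall>k. real k \<le> (1 - e) * real n \<longrightarrow> good_number TYPE('a::euclidean_space) k n"
proof -
  let ?\<delta> = "missed DIM('a)"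
  have "(\<lambda>t. (1 - ?\<delta>) ^ t) \<longlonglongrightarrow> 0"
    using missed_bounds[of "DIM('a)"] by (intro LIMSEQ_realpow_zero) auto
  then obtain t where t: "(1 - ?\<delta>) ^ t < e / 2"
    using order_tendstoD(2)[of _ 0 sequentially "e / 2"] e by (auto simp: eventually_sequentially)
  define B where "B = real (pieces DIM('a)) ^ t / ?\<delta>"
  have "\<forall>\<^sub>F n in sequentially. 2 * B / e \<le> real n \<and> 0 < n"
    by (intro eventually_conj eventually_gt_at_top) real_asymp
  then show ?thesis
  proof (rule eventually_mono, intro allI impI)
    fix n k assume n: "2 * B / e \<le> real n \<and> 0 < n" and k: "real k \<le> (1 - e) * real n"
    have "B \<le> e / 2 * real n" using n e by (simp add: field_simps)
    moreover have "(1 - ?\<delta>) ^ t * real n \<le> e / 2 * real n" using t by (intro mult_right_mono) auto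
    ultimately have "real k + (1 - ?\<delta>) ^ t * real n + B \<le> real n"
      using k by (simp add: algebra_simps)
    then show "good_number TYPE('a) k n" using n good_numberI unfolding B_def by blast
  qed
qed

theorem avoidance_number_asymptotics:
  "(\<lambda>k. real (avoidance_number TYPE('a::euclidean_space) k) / real k) \<longlonglongrightarrow> 1"
proof (rule LIMSEQ_I)
  fix r :: real assume "0 < r"
  define e where "e = min (r / 4) (1 / 2)"
  have e: "0 < e" "e < 1" "e \<le> 1/2" "4 * e \<le> r" using \<open>0 < r\<close> by (auto simp: e_def)
  obtain n0 where n0: "\<And>n k. n \<ge> n0 \<Longrightarrow> real k \<le> (1 - e) * real n \<Longrightarrow> good_number TYPE('a) k n"
    using eventually_good_number[OF e(1,2), where 'a='a] unfolding eventually_sequentially by blast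
  have "norm (real (avoidance_number TYPE('a) k) / real k - 1) < r"
    if k: "k \<ge> n0" "k \<ge> 1" "1 / real k < e" for k
  proof -
    \<comment> \<open>The least \<open>n\<close> for which a fraction \<open>e\<close> of crossed parts is affordable.\<close>
    define n where "n = nat \<lceil>real k / (1 - e)\<rceil>"
    have nk: "real k / (1 - e) \<le> real n" "real n \<le> real k / (1 - e) + 1"
      using e k by (simp_all add: n_def)
    then have "real k \<le> (1 - e) * real n" using e by (simp add: field_simps)
    moreover have "(1 - e) * real n \<le> 1 * real n" using e by (intro mult_right_mono) auto
    ultimately have kn: "real k \<le> (1 - e) * real n" "k \<le> n" by auto
    then have gn: "0 < n \<and> good_number TYPE('a) k n" using n0 k by auto
    let ?N = "avoidance_number TYPE('a) k"
    have "?N \<le> n" unfolding avoidance_number_def using gn by (rule Least_le)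
    moreover have "k \<le> ?N"
      using LeastI[of "\<lambda>n. 0 < n \<and> good_number TYPE('a) k n", OF gn] good_number_ge
      unfolding avoidance_number_def by blast
    ultimately have N: "real k \<le> real ?N" "real ?N \<le> real k / (1 - e) + 1" using nk by auto
    have "1 / (1 - e) \<le> 1 + 2 * e" using e by (simp add: field_simps)
    then have "real k / (1 - e) \<le> (1 + 2 * e) * real k"
      using mult_right_mono[of "1 / (1 - e)" "1 + 2 * e" "real k"] by simp
    moreover have "1 \<le> e * real k" using k by (simp add: field_simps)
    ultimately have "real ?N \<le> (1 + 3 * e) * real k" using N by (simp add: algebra_simps)
    then have "real ?N / real k \<le> 1 + 3 * e" using k by (simp add: divide_le_eq)
    moreover have "1 \<le> real ?N / real k" using N k by simp
    ultimately show ?thesis using e by simp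
  qed
  moreover have "\<forall>\<^sub>F k in sequentially. k \<ge> n0 \<and> k \<ge> 1 \<and> 1 / real k < e"
    using e by (intro eventually_conj eventually_ge_at_top) real_asymp
  ultimately show "\<exists>m. \<forall>k\<ge>m. norm (real (avoidance_number TYPE('a) k) / real k - 1) < r"
    unfolding eventually_sequentially by blast
qed

theorem theorem4:
  "(\<lambda>k. real (avoidance_number TYPE(real ^ 'd::finite) k) / real k) \<longlonglongrightarrow> 1"
  by (rule avoidance_number_asymptotics)

end
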